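(* Let $X,Y$ be indeterminates, let $b_0=X$, $b_k=2k-1+X+Y$ for $k>0$, and $\lambda_k=(k-1+X)(k-1+Y)$ for $k\ge1$. Then for every $n\ge0$, \[ \mu_n(b_k,\lambda_k)=\sum_{\pi\in\mathfrak S_n}X^{\mathrm{RLmin}(\pi)}Y^{\mathrm{LRmax}(\pi)-\mathrm{pivot}(\pi)} . \]
   Context: For sequences $(b_k)_{k\ge0}$, $(\lambda_k)_{k\ge1}$ let $p_n$ be the monic polynomials with $p_{-1}=0$, $p_0=1$, $p_{n+1}=(x-b_n)p_n-\lambda_np_{n-1}$; $\mu_n(b_k,\lambda_k)$ denotes $\mathcal L(x^n)$, where $\mathcal L$ is the unique linear functional on polynomials with $\mathcal L(1)=1$ and $\mathcal L(p_m)=0$ for all $m\ge1$ (the $n$-th moment). $\mathfrak S_n$ is the set of permutations $\pi=\pi_1\cdots\pi_n$ of $\{1,\dots,n\}$. $\pi_i$ is a right-to-left minimum if $\pi_i<\pi_j$ for all $j>i$, and a left-to-right maximum if $\pi_i>\pi_j$ for all $j<i$; $\mathrm{RLmin}(\pi)$, $\mathrm{LRmax}(\pi)$ are their numbers. A pivot of $\pi$ is an entry that is both a left-to-right maximum and a right-to-left minimum; $\mathrm{pivot}(\pi)$ is the number of pivots. *)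

theory Defs
  imports "HOL-Computational_Algebra.Polynomial" "HOL-Combinatorics.Permutations"
begin

text \<open>The convention \<open>p\<^sub>-\<^sub>1 = 0\<close> is built into the second equation; the value \<open>l 0\<close> is never used.\<close>

fun orth_poly :: "(nat \<Rightarrow> 'r) \<Rightarrow> (nat \<Rightarrow> 'r) \<Rightarrow> nat \<Rightarrow> 'r::comm_ring_1 poly" where
  "orth_poly b l 0 = 1"
| "orth_poly b l (Suc 0) = [:- b 0, 1:]"
| "orth_poly b l (Suc (Suc n)) =
     [:- b (Suc n), 1:] * orth_poly b l (Suc n) - smult (l (Suc n)) (orth_poly b l n)"

definition moment_functional ::
  "(nat \<Rightarrow> 'r) \<Rightarrow> (nat \<Rightarrow> 'r) \<Rightarrow> ('r::comm_ring_1 poly \<Rightarrow> 'r) \<Rightarrow> bool" where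
  "moment_functional b l L \<longleftrightarrow>
     module_hom smult (*) L \<and> L 1 = 1 \<and> (\<forall>m\<ge>1. L (orth_poly b l m) = 0)"

definition moment :: "(nat \<Rightarrow> 'r) \<Rightarrow> (nat \<Rightarrow> 'r) \<Rightarrow> nat \<Rightarrow> 'r::comm_ring_1" where
  "moment b l n = (THE L. moment_functional b l L) (monom 1 n)"

text \<open>The functional in the definition of \<^const>\<open>moment\<close> exists and is unique.\<close>

lemma orth_poly_monic:
  "degree (orth_poly b l n) = n \<and> coeff (orth_poly b l n) n = (1::'r::comm_ring_1)"
proof (induction b l n rule: orth_poly.induct)
  case (3 b l n)
  let ?p = "orth_poly b l (Suc n)" and ?q = "orth_poly b l n"
  have eq: "orth_poly b l (Suc (Suc n)) = pCons 0 ?p - smult (b (Suc n)) ?p - smult (l (Suc n)) ?q"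
    by simp
  have c: "coeff (orth_poly b l (Suc (Suc n))) (Suc (Suc n)) = 1"
    unfolding eq using 3 by (simp add: coeff_eq_0)
  have "degree (orth_poly b l (Suc (Suc n))) \<le> Suc (Suc n)"
    unfolding eq using 3
    by (intro degree_le) (auto simp: coeff_pCons coeff_eq_0 split: nat.split)
  moreover have "Suc (Suc n) \<le> degree (orth_poly b l (Suc (Suc n)))"
    by (rule le_degree) (use c in simp)
  ultimately have "degree (orth_poly b l (Suc (Suc n))) = Suc (Suc n)" by (rule antisym)
  with c show ?case by blast
qed simp_all

fun moment_rec :: "(nat \<Rightarrow> 'r) \<Rightarrow> (nat \<Rightarrow> 'r) \<Rightarrow> nat \<Rightarrow> 'r::comm_ring_1" where
  "moment_rec b l n =
     (if n = 0 then 1 else - (\<Sum>i<n. coeff (orth_poly b l n) i * moment_rec b l i))"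

declare moment_rec.simps [simp del]

lemma module_smult: "module (smult :: 'r::comm_ring_1 \<Rightarrow> _)"
  by unfold_locales (simp_all add: smult_add_right smult_add_left)

lemma module_times: "module ((*) :: 'r::comm_ring_1 \<Rightarrow> _)"
  by unfold_locales (simp_all add: algebra_simps)

lemma moment_functional_exists:
  "\<exists>L. moment_functional b l (L :: 'r::comm_ring_1 poly \<Rightarrow> 'r)"
proof
  define L where "L p = (\<Sum>i\<le>degree p. coeff p i * moment_rec b l i)" for p :: "'r poly"
  have L: "L p = (\<Sum>i\<le>N. coeff p i * moment_rec b l i)" if "degree p \<le> N" for p N
    unfolding L_def using that by (intro sum.mono_neutral_left) (auto simp: coeff_eq_0)
  have "L (p + q) = L p + L q" for p q
  proof -
    let ?N = "max (degree p) (degree q)"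
    show ?thesis
      by (simp add: L[of _ ?N] degree_add_le_max sum.distrib algebra_simps)
  qed
  moreover have "L (smult c p) = c * L p" for c p
    by (simp add: L[of _ "degree p"] degree_smult_le sum_distrib_left mult.assoc)
  ultimately have "module_hom smult (*) L"
    by (intro module_hom.intro module_smult module_times module_hom_axioms.intro)
  moreover have "L 1 = 1" by (simp add: L_def moment_rec.simps)
  moreover have "L (orth_poly b l m) = 0" if "m \<ge> 1" for m
  proof -
    have "L (orth_poly b l m) = (\<Sum>i\<le>m. coeff (orth_poly b l m) i * moment_rec b l i)"
      using orth_poly_monic[of b l m] by (simp add: L_def)
    also have "\<dots> = (\<Sum>i<m. coeff (orth_poly b l m) i * moment_rec b l i) + moment_rec b l m"
      using orth_poly_monic[of b l m] by (simp flip: lessThan_Suc_atMost)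
    also have "\<dots> = 0" using that by (subst (2) moment_rec.simps) simp
    finally show ?thesis .
  qed
  ultimately show "moment_functional b l L" by (simp add: moment_functional_def)
qed

lemma moment_functional_eq_moment_rec:
  assumes "moment_functional b l (L :: 'r::comm_ring_1 poly \<Rightarrow> 'r)"
  shows "L p = (\<Sum>i\<le>degree p. coeff p i * moment_rec b l i)"
proof -
  interpret module_hom smult "(*)" L using assms by (simp add: moment_functional_def)
  have L: "L p = (\<Sum>i\<le>degree p. coeff p i * L (monom 1 i))" for p
  proof -
    have "L p = L (\<Sum>i\<le>degree p. smult (coeff p i) (monom 1 i))"
      by (simp add: smult_monom poly_as_sum_of_monoms)
    then show ?thesis by (simp add: sum scale)
  qed
  have "L (monom 1 n) = moment_rec b l n" for n
  proof (induction n rule: less_induct)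
    case (less n)
    show ?case
    proof (cases "n = 0")
      case True
      then show ?thesis using assms by (simp add: moment_functional_def moment_rec.simps)
    next
      case False
      have "0 = L (orth_poly b l n)" using False assms by (simp add: moment_functional_def)
      also have "\<dots> = (\<Sum>i\<le>n. coeff (orth_poly b l n) i * L (monom 1 i))"
        using L[of "orth_poly b l n"] orth_poly_monic[of b l n] by simp
      also have "\<dots> = (\<Sum>i<n. coeff (orth_poly b l n) i * L (monom 1 i)) + L (monom 1 n)"
        using orth_poly_monic[of b l n] by (simp flip: lessThan_Suc_atMost)
      also have "(\<Sum>i<n. coeff (orth_poly b l n) i * L (monom 1 i)) =
          (\<Sum>i<n. coeff (orth_poly b l n) i * moment_rec b l i)"
        using less by simp
      finally show ?thesis using False
        by (subst moment_rec.simps) (simp add: eq_neg_iff_add_eq_0 add.commute)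
    qed
  qed
  then show ?thesis using L[of p] by simp
qed

lemma moment_functional_unique: "\<exists>!L. moment_functional b l (L :: 'r::comm_ring_1 poly \<Rightarrow> 'r)"
proof -
  obtain L where L: "moment_functional b l (L :: 'r poly \<Rightarrow> 'r)"
    using moment_functional_exists by blast
  show ?thesis
  proof (rule ex1I)
    show "moment_functional b l L" by (fact L)
  next
    fix K assume "moment_functional b l (K :: 'r poly \<Rightarrow> 'r)"
    then show "K = L" using L by (auto simp: moment_functional_eq_moment_rec)
  qed
qed

text \<open>
  A permutation \<open>\<pi>\<close> of \<open>{1..n}\<close> is a function with \<open>\<pi> permutes {1..n}\<close>, read as the word
  \<open>\<pi> 1 \<dots> \<pi> n\<close>. As the entries of the word are distinct, entries are counted by their positions.
\<close>

definition rl_minima :: "nat \<Rightarrow> (nat \<Rightarrow> nat) \<Rightarrow> nat set" where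
  "rl_minima n \<pi> = {i \<in> {1..n}. \<forall>j\<in>{1..n}. j > i \<longrightarrow> \<pi> i < \<pi> j}"

definition lr_maxima :: "nat \<Rightarrow> (nat \<Rightarrow> nat) \<Rightarrow> nat set" where
  "lr_maxima n \<pi> = {i \<in> {1..n}. \<forall>j\<in>{1..n}. j < i \<longrightarrow> \<pi> i > \<pi> j}"

definition RLmin :: "nat \<Rightarrow> (nat \<Rightarrow> nat) \<Rightarrow> nat" where
  "RLmin n \<pi> = card (rl_minima n \<pi>)"

definition LRmax :: "nat \<Rightarrow> (nat \<Rightarrow> nat) \<Rightarrow> nat" where
  "LRmax n \<pi> = card (lr_maxima n \<pi>)"

definition pivot :: "nat \<Rightarrow> (nat \<Rightarrow> nat) \<Rightarrow> nat" where
  "pivot n \<pi> = card (lr_maxima n \<pi> \<inter> rl_minima n \<pi>)"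

text \<open>Hence \<open>LRmax n \<pi> - pivot n \<pi>\<close> is never truncated.\<close>

lemma pivot_le_LRmax: "pivot n \<pi> \<le> LRmax n \<pi>"
  unfolding pivot_def LRmax_def by (rule card_mono) (auto simp: lr_maxima_def)

text \<open>The two indeterminates of the polynomial ring \<open>R[X][Y]\<close> over a commutative ring \<open>R\<close>.\<close>

definition indet_X :: "'a::comm_ring_1 poly poly" where
  "indet_X = [:[:0, 1:]:]"

definition indet_Y :: "'a::comm_ring_1 poly poly" where
  "indet_Y = [:0, 1:]"

end

theory Submission
  imports Defs
begin

text \<open>
  Restricting the graph of a permutation to \<open>{1..n} \<times> {1..n}\<close> gives a rook placement \<open>R\<close>. Give a
  rook \<open>(i, v)\<close> with \<open>v \<le> i\<close> the factor \<open>X\<close> if all values below \<open>v\<close> occur before position \<open>i\<close>, a rook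
  with \<open>i < v\<close> the factor \<open>Y\<close> if all positions before \<open>i\<close> carry values below \<open>v\<close>, and the factor \<open>1\<close>
  otherwise. On a full placement these rooks are the right-to-left minima and the left-to-right
  maxima that are not pivots, because pivots are exactly the left-to-right maxima that are fixed points.

  A placement with \<open>k\<close> free rows and \<open>k\<close> free columns is extended to row and column \<open>n + 1\<close> by placing
  nothing, the corner, a rook in the new column (in one of the \<open>k\<close> free rows, total weight
  \<open>k - 1 + Y\<close>, as only the least free row gives \<open>Y\<close>), a rook in the new row (total weight
  \<open>k - 1 + X\<close>), or both of the latter. This is the recurrence
  \<open>x p\<^sub>k = p\<^sub>k\<^sub>+\<^sub>1 + b\<^sub>k p\<^sub>k + \<lambda>\<^sub>k p\<^sub>k\<^sub>-\<^sub>1\<close>, so \<open>x\<^sup>n\<close> is the sum over all placements of the weight times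
  \<open>p\<^sub>k\<close>, and the moment functional keeps the terms with \<open>k = 0\<close>.
\<close>

section \<open>Rook placements, their weights, free rows and free columns\<close>

definition rook_placements :: "nat \<Rightarrow> (nat \<times> nat) set set" where
  "rook_placements n = {R. R \<subseteq> {1..n} \<times> {1..n} \<and> inj_on fst R \<and> inj_on snd R}"

text \<open>Diagonal cells fall under the first case, so a pivot, being a fixed point, gets
  \<open>x\<close> and never \<open>y\<close>. This accounts for the subtraction of
  \<open>pivot\<close> in the exponent of \<open>Y\<close>.\<close>

definition rook_factor :: "'r::comm_ring_1 \<Rightarrow> 'r \<Rightarrow> (nat \<times> nat) set \<Rightarrow> nat \<times> nat \<Rightarrow> 'r" where
  "rook_factor x y R = (\<lambda>(i, v).
     if v \<le> i then (if \<forall>u\<in>{1..<v}. \<exists>j<i. (j, u) \<in> R then x else 1)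
     else (if \<forall>j\<in>{1..<i}. \<exists>u<v. (j, u) \<in> R then y else 1))"

definition rook_weight :: "'r::comm_ring_1 \<Rightarrow> 'r \<Rightarrow> (nat \<times> nat) set \<Rightarrow> 'r" where
  "rook_weight x y R = (\<Prod>r\<in>R. rook_factor x y R r)"

definition free_rows :: "nat \<Rightarrow> (nat \<times> nat) set \<Rightarrow> nat set" where
  "free_rows n R = {1..n} - fst ` R"

definition free_columns :: "nat \<Rightarrow> (nat \<times> nat) set \<Rightarrow> nat set" where
  "free_columns n R = {1..n} - snd ` R"

text \<open>With \<open>I\<close> and \<open>V\<close> the free rows and columns of a placement in
  the square of side \<open>m - 1\<close>, these are exactly the sets of rooks in row or column
  \<open>m\<close> that it can gain.\<close>

definition corner_extensions :: "nat \<Rightarrow> nat set \<Rightarrow> nat set \<Rightarrow> (nat \<times> nat) set set" where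
  "corner_extensions m I V = {{}, {(m, m)}} \<union> (\<lambda>i. {(i, m)}) ` I \<union> (\<lambda>v. {(m, v)}) ` V
     \<union> (\<lambda>(i, v). {(i, m), (m, v)}) ` (I \<times> V)"

lemma finite_rook_placements: "finite (rook_placements n)"
  by (rule finite_subset[of _ "Pow ({1..n} \<times> {1..n})"]) (auto simp: rook_placements_def)

lemma finite_rook_placement: "R \<in> rook_placements n \<Longrightarrow> finite R"
  by (rule finite_subset[of _ "{1..n} \<times> {1..n}"]) (auto simp: rook_placements_def)

lemma card_free_rows:
  assumes "R \<in> rook_placements n"
  shows "card (free_rows n R) = n - card R"
proof -
  have "fst ` R \<subseteq> {1..n}" "card (fst ` R) = card R"
    using assms by (auto simp: rook_placements_def card_image)
  then show ?thesis
    using finite_rook_placement[OF assms] by (simp add: free_rows_def card_Diff_subset)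
qed

lemma card_free_columns:
  assumes "R \<in> rook_placements n"
  shows "card (free_columns n R) = n - card R"
proof -
  have "snd ` R \<subseteq> {1..n}" "card (snd ` R) = card R"
    using assms by (auto simp: rook_placements_def card_image)
  then show ?thesis
    using finite_rook_placement[OF assms] by (simp add: free_columns_def card_Diff_subset)
qed

lemma card_rook_placement_le:
  assumes "R \<in> rook_placements n"
  shows "card R \<le> n"
proof -
  have "card (fst ` R) \<le> card {1..n}"
    using assms by (intro card_mono) (auto simp: rook_placements_def)
  then show ?thesis
    using assms by (simp add: rook_placements_def card_image)
qed

section \<open>Extending a placement by one row and one column\<close>

lemma sum_corner_extensions:
  fixes f :: "(nat \<times> nat) set \<Rightarrow> 'r::comm_ring_1"
  assumes "finite I" "finite V" "m \<notin> I" "m \<notin> V"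
  shows "sum f (corner_extensions m I V) = f {} + f {(m, m)} + (\<Sum>i\<in>I. f {(i, m)})
    + (\<Sum>v\<in>V. f {(m, v)}) + (\<Sum>i\<in>I. \<Sum>v\<in>V. f {(i, m), (m, v)})"
proof -
  let ?A = "{{}, {(m, m)}}" and ?B = "(\<lambda>i. {(i, m)}) ` I" and ?C = "(\<lambda>v. {(m, v)}) ` V"
  let ?D = "(\<lambda>(i, v). {(i, m), (m, v)}) ` (I \<times> V)"
  \<comment> \<open>Since \<open>m\<close> lies in neither \<open>I\<close> nor \<open>V\<close>, a
    rook in the new column is never one in the new row. Hence the families are disjoint, and the
    two-rook sets determine \<open>i\<close> and \<open>v\<close>.\<close>
  have "sum f (corner_extensions m I V) = sum f ?A + sum f ?B + sum f ?C + sum f ?D"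
  proof -
    have "sum f (?A \<union> ?B \<union> ?C \<union> ?D) = sum f (?A \<union> ?B \<union> ?C) + sum f ?D"
      using assms by (intro sum.union_disjoint) (auto simp: doubleton_eq_iff)
    moreover have "sum f (?A \<union> ?B \<union> ?C) = sum f (?A \<union> ?B) + sum f ?C"
      using assms by (intro sum.union_disjoint) auto
    moreover have "sum f (?A \<union> ?B) = sum f ?A + sum f ?B"
      using assms by (intro sum.union_disjoint) auto
    ultimately show ?thesis by (simp only: corner_extensions_def)
  qed
  moreover have "sum f ?B = (\<Sum>i\<in>I. f {(i, m)})"
    by (subst sum.reindex) (auto simp: inj_on_def)
  moreover have "sum f ?C = (\<Sum>v\<in>V. f {(m, v)})"
    by (subst sum.reindex) (auto simp: inj_on_def)
  moreover have "sum f ?D = (\<Sum>i\<in>I. \<Sum>v\<in>V. f {(i, m), (m, v)})"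
    by (subst sum.reindex)
      (use assms in \<open>auto simp: inj_on_def doubleton_eq_iff sum.cartesian_product case_prod_unfold\<close>)
  ultimately show ?thesis by simp
qed

text \<open>The inverse cuts a placement into the rooks inside the square of side \<open>n\<close>
  and those in the last row or column. The two inclusions are the substance: the union attacks
  nowhere, and the part outside the square is one of the listed extensions.\<close>

lemma bij_betw_corner_extensions:
  "bij_betw (\<lambda>(R, N). R \<union> N)
     (SIGMA R : rook_placements n. corner_extensions (Suc n) (free_rows n R) (free_columns n R))
     (rook_placements (Suc n))"
proof (rule bij_betw_byWitness[where
      f' = "\<lambda>R. (R \<inter> {1..n} \<times> {1..n}, R - {1..n} \<times> {1..n})"], goal_cases)
  case 1
  show ?case
    by (auto simp: rook_placements_def corner_extensions_def free_rows_def free_columns_def)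
next
  case 2
  show ?case by auto
next
  case 3
  show ?case
  proof clarify
    fix R N
    assume R: "R \<in> rook_placements n"
      and N: "N \<in> corner_extensions (Suc n) (free_rows n R) (free_columns n R)"
    have sub: "fst ` R \<subseteq> {1..n}" "snd ` R \<subseteq> {1..n}" and inj: "inj_on fst R" "inj_on snd R"
      using R by (auto simp: rook_placements_def)
    have "fst ` N \<subseteq> insert (Suc n) (free_rows n R)"
      using N by (auto simp: corner_extensions_def)
    then have rows: "fst ` N \<subseteq> {1..Suc n}" "fst ` R \<inter> fst ` N = {}"
      using sub(1) by (force simp: free_rows_def)+
    have "snd ` N \<subseteq> insert (Suc n) (free_columns n R)"
      using N by (auto simp: corner_extensions_def)
    then have cols: "snd ` N \<subseteq> {1..Suc n}" "snd ` R \<inter> snd ` N = {}"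
      using sub(2) by (force simp: free_columns_def)+
    have "inj_on fst N" "inj_on snd N"
      using N by (auto simp: corner_extensions_def free_rows_def free_columns_def)
    then have "inj_on fst (R \<union> N)" "inj_on snd (R \<union> N)"
      using inj rows(2) cols(2) by (auto simp: inj_on_Un)
    moreover have "r \<in> {1..Suc n} \<times> {1..Suc n}" if "r \<in> R \<union> N" for r
    proof -
      have "fst r \<in> {1..Suc n}" "snd r \<in> {1..Suc n}"
        using that sub rows(1) cols(1) by fastforce+
      then show ?thesis by (simp add: mem_Times_iff)
    qed
    ultimately show "R \<union> N \<in> rook_placements (Suc n)"
      by (auto simp: rook_placements_def)
  qed
next
  case 4
  show ?case
  proof (clarify, rule)
    fix R assume R: "R \<in> rook_placements (Suc n)"
    let ?m = "Suc n" and ?R = "R \<inter> {1..n} \<times> {1..n}" and ?N = "R - {1..n} \<times> {1..n}"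
    have sub: "R \<subseteq> {1..?m} \<times> {1..?m}" and inj: "inj_on fst R" "inj_on snd R"
      using R by (auto simp: rook_placements_def)
    show "?R \<in> rook_placements n"
      using inj by (auto simp: rook_placements_def intro: inj_on_subset)
    have row: "v = w" if "(i, v) \<in> R" "(i, w) \<in> R" for i v w
      using inj_onD[OF inj(1) _ that] by simp
    have col: "i = j" if "(i, v) \<in> R" "(j, v) \<in> R" for i j v
      using inj_onD[OF inj(2) _ that] by simp
    have N: "?N = {(i, v) \<in> R. i = ?m \<or> v = ?m}"
      using sub by (auto simp: le_Suc_eq)
    have free_row: "i \<in> free_rows n ?R" if "(i, ?m) \<in> R" "i \<noteq> ?m" for i
    proof -
      have "v = ?m" if "(i, v) \<in> R" for v using row that \<open>(i, ?m) \<in> R\<close> by blast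
      then have "i \<notin> fst ` ?R" by fastforce
      then show ?thesis using sub that by (auto simp: free_rows_def)
    qed
    have free_col: "v \<in> free_columns n ?R" if "(?m, v) \<in> R" "v \<noteq> ?m" for v
    proof -
      have "i = ?m" if "(i, v) \<in> R" for i using col that \<open>(?m, v) \<in> R\<close> by blast
      then have "v \<notin> snd ` ?R" by fastforce
      then show ?thesis using sub that by (auto simp: free_columns_def)
    qed
    \<comment> \<open>Row \<open>?m\<close> and column \<open>?m\<close> hold at most one rook each,
      so the cases below match the five kinds of extension.\<close>
    consider (corner) "(?m, ?m) \<in> R"
      | (both) i v where "(i, ?m) \<in> R" "i \<noteq> ?m" "(?m, v) \<in> R" "v \<noteq> ?m"
      | (last_column) i where "(i, ?m) \<in> R" "i \<noteq> ?m" "\<And>v. (?m, v) \<notin> R"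
      | (last_row) v where "(?m, v) \<in> R" "v \<noteq> ?m" "\<And>i. (i, ?m) \<notin> R"
      | (none) "\<And>i. (i, ?m) \<notin> R" "\<And>v. (?m, v) \<notin> R"
      by metis
    then show "?N \<in> corner_extensions ?m (free_rows n ?R) (free_columns n ?R)"
    proof cases
      case corner
      then have "?N = {(?m, ?m)}" unfolding N using row col by blast
      then show ?thesis by (simp add: corner_extensions_def)
    next
      case (both i v)
      then have "?N = {(i, ?m), (?m, v)}" unfolding N using row col by blast
      then show ?thesis using both free_row free_col
        by (auto simp: corner_extensions_def)
    next
      case (last_column i)
      then have "?N = {(i, ?m)}" unfolding N using col by blast
      then show ?thesis using last_column free_row by (auto simp: corner_extensions_def)
    next
      case (last_row v)
      then have "?N = {(?m, v)}" unfolding N using row by blast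
      then show ?thesis using last_row free_col by (auto simp: corner_extensions_def)
    next
      case none
      then have "?N = {}" unfolding N by blast
      then show ?thesis by (simp add: corner_extensions_def)
    qed
  qed
qed

text \<open>A factor depends only on the rooks that are smaller in both coordinates, so a rook in the last
  row or column affects no other factor.\<close>

lemma rook_factor_extend:
  assumes "N \<in> corner_extensions (Suc n) I V" "i \<le> Suc n" "v \<le> Suc n"
  shows "rook_factor x y (R \<union> N) (i, v) = rook_factor x y R (i, v)"
proof -
  have "(j, u) \<in> R \<union> N \<longleftrightarrow> (j, u) \<in> R" if "j < i" "u < v" for j u
    using assms that by (auto simp: corner_extensions_def)
  then have "(\<forall>u\<in>{1..<v}. \<exists>j<i. (j, u) \<in> R \<union> N) \<longleftrightarrow> (\<forall>u\<in>{1..<v}. \<exists>j<i. (j, u) \<in> R)"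
    "(\<forall>j\<in>{1..<i}. \<exists>u<v. (j, u) \<in> R \<union> N) \<longleftrightarrow> (\<forall>j\<in>{1..<i}. \<exists>u<v. (j, u) \<in> R)"
    by (meson atLeastLessThan_iff)+
  then show ?thesis
    unfolding rook_factor_def prod.case by (simp only:)
qed

text \<open>Every new rook is judged against the old placement \<open>R\<close> alone. This holds
  even when two rooks are added, as neither of them is smaller than the other in both coordinates;
  so their factors can be summed independently.\<close>

lemma rook_weight_extend:
  assumes R: "R \<in> rook_placements n"
    and N: "N \<in> corner_extensions (Suc n) (free_rows n R) (free_columns n R)"
  shows "rook_weight x y (R \<union> N) = rook_weight x y R * (\<Prod>r\<in>N. rook_factor x y R r)"
proof -
  have RN: "R \<union> N \<subseteq> {1..Suc n} \<times> {1..Suc n}" "finite N" "R \<inter> N = {}"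
    using R N
    by (auto simp: rook_placements_def corner_extensions_def free_rows_def free_columns_def)
  have "rook_weight x y (R \<union> N) = (\<Prod>r\<in>R \<union> N. rook_factor x y R r)"
    unfolding rook_weight_def
  proof (rule prod.cong)
    fix r assume "r \<in> R \<union> N"
    then have "fst r \<le> Suc n" "snd r \<le> Suc n" using RN(1) by auto
    then show "rook_factor x y (R \<union> N) r = rook_factor x y R r"
      using rook_factor_extend[OF N, of "fst r" "snd r"] by simp
  qed simp
  then show ?thesis
    using RN finite_rook_placement[OF R] by (simp add: prod.union_disjoint rook_weight_def)
qed

section \<open>Total weight of all extensions of one placement\<close>

lemma sum_if_least:
  fixes y :: "'r::comm_ring_1"
  assumes "finite (A :: nat set)" and "A \<noteq> {}"
  shows "(\<Sum>i\<in>A. if \<forall>j\<in>A. i \<le> j then y else 1) = of_nat (card A) - 1 + y"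
proof -
  \<comment> \<open>The condition singles out \<open>Min A\<close>, which exists because
    \<open>A\<close> is nonempty; the remaining \<open>card A - 1\<close> elements contribute 1
    each.\<close>
  have "(\<Sum>i\<in>A. if \<forall>j\<in>A. i \<le> j then y else 1)
      = (\<Sum>i\<in>insert (Min A) (A - {Min A}). if i = Min A then y else 1)"
    using assms by (intro sum.cong) (auto intro: antisym Min_in Min_le)
  also have "\<dots> = y + of_nat (card (A - {Min A}))"
    using assms by (subst sum.insert) auto
  also have "\<dots> = of_nat (card A) - 1 + y"
    using assms card_gt_0_iff[of A] by (simp add: card_Diff_singleton of_nat_diff)
  finally show ?thesis .
qed

text \<open>A rook \<open>(i, Suc n)\<close> with \<open>i \<le> n\<close> lies in the
  \<open>y\<close> case. All old values are below \<open>Suc n\<close>, so its condition says that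
  every earlier row is occupied, which makes \<open>i\<close> the least free row.\<close>

lemma sum_rook_factor_last_column:
  fixes x y :: "'r::comm_ring_1"
  assumes R: "R \<in> rook_placements n"
  shows "(\<Sum>i\<in>free_rows n R. rook_factor x y R (i, Suc n))
    = (if card R = n then 0 else of_nat (n - card R) - 1 + y)"
proof -
  have "rook_factor x y R (i, Suc n) = (if \<forall>j\<in>free_rows n R. i \<le> j then y else 1)"
    if "i \<in> free_rows n R" for i
  proof -
    have "(\<exists>u<Suc n. (j, u) \<in> R) \<longleftrightarrow> j \<notin> free_rows n R" if "j \<in> {1..<i}" for j
      using that \<open>i \<in> free_rows n R\<close> R by (force simp: free_rows_def rook_placements_def)
    then have "(\<forall>j\<in>{1..<i}. \<exists>u<Suc n. (j, u) \<in> R) \<longleftrightarrow> (\<forall>j\<in>{1..<i}. j \<notin> free_rows n R)"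
      by blast
    also have "\<dots> \<longleftrightarrow> (\<forall>j\<in>free_rows n R. i \<le> j)"
      unfolding free_rows_def
      by (metis DiffD1 atLeastAtMost_iff atLeastLessThan_iff not_le)
    finally show ?thesis
      using that by (simp add: rook_factor_def free_rows_def)
  qed
  then have "(\<Sum>i\<in>free_rows n R. rook_factor x y R (i, Suc n))
      = (\<Sum>i\<in>free_rows n R. if \<forall>j\<in>free_rows n R. i \<le> j then y else 1)"
    by simp
  moreover have "finite (free_rows n R)" by (simp add: free_rows_def)
  ultimately show ?thesis
    using sum_if_least[of "free_rows n R" y] card_free_rows[OF R] card_rook_placement_le[OF R]
    by (cases "free_rows n R = {}") (auto simp: card_eq_0_iff)
qed

text \<open>Dually, a rook \<open>(Suc n, v)\<close> lies in the \<open>x\<close> case and earns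
  \<open>x\<close> exactly when \<open>v\<close> is the least free column.\<close>

lemma sum_rook_factor_last_row:
  fixes x y :: "'r::comm_ring_1"
  assumes R: "R \<in> rook_placements n"
  shows "(\<Sum>v\<in>free_columns n R. rook_factor x y R (Suc n, v))
    = (if card R = n then 0 else of_nat (n - card R) - 1 + x)"
proof -
  have "rook_factor x y R (Suc n, v) = (if \<forall>u\<in>free_columns n R. v \<le> u then x else 1)"
    if "v \<in> free_columns n R" for v
  proof -
    have "(\<exists>j<Suc n. (j, u) \<in> R) \<longleftrightarrow> u \<notin> free_columns n R" if "u \<in> {1..<v}" for u
      using that \<open>v \<in> free_columns n R\<close> R by (force simp: free_columns_def rook_placements_def)
    then have "(\<forall>u\<in>{1..<v}. \<exists>j<Suc n. (j, u) \<in> R) \<longleftrightarrow> (\<forall>u\<in>{1..<v}. u \<notin> free_columns n R)"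
      by blast
    also have "\<dots> \<longleftrightarrow> (\<forall>u\<in>free_columns n R. v \<le> u)"
      unfolding free_columns_def
      by (metis DiffD1 atLeastAtMost_iff atLeastLessThan_iff not_le)
    finally show ?thesis
      using that by (simp add: rook_factor_def free_columns_def)
  qed
  then have "(\<Sum>v\<in>free_columns n R. rook_factor x y R (Suc n, v))
      = (\<Sum>v\<in>free_columns n R. if \<forall>u\<in>free_columns n R. v \<le> u then x else 1)"
    by simp
  moreover have "finite (free_columns n R)" by (simp add: free_columns_def)
  ultimately show ?thesis
    using sum_if_least[of "free_columns n R" x] card_free_columns[OF R] card_rook_placement_le[OF R]
    by (cases "free_columns n R = {}") (auto simp: card_eq_0_iff)
qed

text \<open>The corner earns \<open>x\<close> only if all old columns are occupied. This is the
  source of the exceptional value of \<open>b 0\<close>: for \<open>k > 0\<close> the corner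
  contributes the summand 1 to \<open>b k\<close>.\<close>

lemma rook_factor_corner:
  assumes R: "R \<in> rook_placements n"
  shows "rook_factor x y R (Suc n, Suc n) = (if card R = n then x else 1)"
proof -
  have "j < Suc n" if "(j, u) \<in> R" for j u
    using R that by (auto simp: rook_placements_def)
  then have "(\<exists>j<Suc n. (j, u) \<in> R) \<longleftrightarrow> u \<in> snd ` R" for u
    by force
  then have "(\<forall>u\<in>{1..<Suc n}. \<exists>j<Suc n. (j, u) \<in> R) \<longleftrightarrow> {1..<Suc n} \<subseteq> snd ` R"
    by blast
  also have "\<dots> \<longleftrightarrow> free_columns n R = {}"
    by (simp add: free_columns_def atLeastLessThanSuc_atLeastAtMost)
  also have "\<dots> \<longleftrightarrow> card (free_columns n R) = 0"
    by (simp add: free_columns_def)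
  also have "\<dots> \<longleftrightarrow> card R = n"
    using card_free_columns[OF R] card_rook_placement_le[OF R] by auto
  finally show ?thesis by (simp add: rook_factor_def)
qed

text \<open>The placements are grouped by their restriction to the smaller square. Leaving
  \<open>g\<close> arbitrary separates this count from the orthogonal polynomials, which are
  substituted for \<open>g\<close> later.\<close>

lemma sum_rook_placements_Suc:
  fixes x y :: "'r::comm_ring_1" and g :: "nat \<Rightarrow> 'r poly"
  shows "(\<Sum>R\<in>rook_placements (Suc n). smult (rook_weight x y R) (g (Suc n - card R)))
    = (\<Sum>R\<in>rook_placements n. smult (rook_weight x y R)
        (if card R = n then g 1 + smult x (g 0)
         else let k = n - card R; s = of_nat k - 1 + x; t = of_nat k - 1 + y
           in g (Suc k) + smult (1 + t + s) (g k) + smult (t * s) (g (k - 1))))"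
    (is "_ = (\<Sum>R\<in>_. ?rhs R)")
proof -
  let ?E = "\<lambda>R. corner_extensions (Suc n) (free_rows n R) (free_columns n R)"
  let ?f = "\<lambda>R. smult (rook_weight x y R) (g (Suc n - card R))"
  have "(\<Sum>R\<in>rook_placements (Suc n). ?f R)
      = (\<Sum>(R, N)\<in>(SIGMA R : rook_placements n. ?E R). ?f (R \<union> N))"
    using sum.reindex_bij_betw[OF bij_betw_corner_extensions, of ?f n]
    by (simp add: case_prod_unfold)
  also have "\<dots> = (\<Sum>R\<in>rook_placements n. \<Sum>N\<in>?E R. ?f (R \<union> N))"
    by (subst sum.Sigma)
      (auto simp: finite_rook_placements corner_extensions_def free_rows_def free_columns_def)
  also have "\<dots> = (\<Sum>R\<in>rook_placements n. ?rhs R)"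
  proof (rule sum.cong)
    fix R assume R: "R \<in> rook_placements n"
    let ?m = "Suc n" and ?I = "free_rows n R" and ?V = "free_columns n R"
    let ?w = "rook_weight x y R" and ?F = "rook_factor x y R" and ?k = "n - card R"
    let ?s = "\<Sum>v\<in>?V. ?F (?m, v)" and ?t = "\<Sum>i\<in>?I. ?F (i, ?m)"
    have fin: "finite ?I" "finite ?V" "?m \<notin> ?I" "?m \<notin> ?V"
      by (auto simp: free_rows_def free_columns_def)
    \<comment> \<open>The side grows by one and \<open>card N\<close> rooks are added, so the number
      of free rows changes from \<open>?k\<close> to \<open>Suc ?k - card N\<close>.\<close>
    have "?f (R \<union> N) = smult ?w (smult (\<Prod>r\<in>N. ?F r) (g (Suc ?k - card N)))"
      if N: "N \<in> ?E R" for N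
    proof -
      have "R \<inter> N = {}" "finite N"
        using R N
        by (auto simp: rook_placements_def corner_extensions_def free_rows_def free_columns_def)
      then have "Suc n - card (R \<union> N) = Suc ?k - card N"
        using card_rook_placement_le[OF R] finite_rook_placement[OF R]
        by (simp add: card_Un_disjoint)
      then show ?thesis by (simp add: rook_weight_extend[OF R N])
    qed
    then have "(\<Sum>N\<in>?E R. ?f (R \<union> N))
        = (\<Sum>N\<in>?E R. smult ?w (smult (\<Prod>r\<in>N. ?F r) (g (Suc ?k - card N))))"
      by simp
    also have "\<dots> = smult ?w (\<Sum>N\<in>?E R. smult (\<Prod>r\<in>N. ?F r) (g (Suc ?k - card N)))"
      by (simp add: module.scale_sum_right[OF module_smult])
    also have "(\<Sum>N\<in>?E R. smult (\<Prod>r\<in>N. ?F r) (g (Suc ?k - card N)))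
        = g (Suc ?k) + smult (?F (?m, ?m)) (g ?k) + (\<Sum>i\<in>?I. smult (?F (i, ?m)) (g ?k))
          + (\<Sum>v\<in>?V. smult (?F (?m, v)) (g ?k))
          + (\<Sum>i\<in>?I. \<Sum>v\<in>?V. smult (?F (i, ?m) * ?F (?m, v)) (g (?k - 1)))"
    proof -
      \<comment> \<open>The two new rooks are distinct, so the set has cardinality 2 and its product
        has two factors.\<close>
      have "(i, ?m) \<noteq> (?m, v)" if "i \<in> ?I" for i v using that fin by auto
      then show ?thesis
        by (subst sum_corner_extensions) (use fin in \<open>auto intro!: sum.cong\<close>)
    qed
    also have "\<dots> = g (Suc ?k) + smult (?F (?m, ?m) + ?t + ?s) (g ?k) + smult (?t * ?s) (g (?k - 1))"
      by (simp add: smult_sum smult_add_left sum_product)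
    \<comment> \<open>If \<open>card R = n\<close>, both sums are 0, so the term with the truncated
      index \<open>?k - 1\<close> vanishes.\<close>
    also have "smult ?w \<dots> = ?rhs R"
      unfolding sum_rook_factor_last_column[OF R] sum_rook_factor_last_row[OF R]
        rook_factor_corner[OF R]
      by (simp add: Let_def)
    finally show "(\<Sum>N\<in>?E R. ?f (R \<union> N)) = ?rhs R" .
  qed simp
  finally show ?thesis .
qed

section \<open>Expansion of the powers of the variable, and the moments\<close>

lemma monom_eq_sum_rook_placements:
  fixes x y :: "'r::comm_ring_1"
  assumes b0: "b 0 = x"
    and b: "\<And>k. k > 0 \<Longrightarrow> b k = 2 * of_nat k - 1 + x + y"
    and l: "\<And>k. k \<ge> 1 \<Longrightarrow> l k = (of_nat k - 1 + x) * (of_nat k - 1 + y)"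
  shows "monom 1 n = (\<Sum>R\<in>rook_placements n. smult (rook_weight x y R) (orth_poly b l (n - card R)))"
proof (induction n)
  case 0
  have "rook_placements 0 = {{}}" by (auto simp: rook_placements_def)
  then show ?case by (simp add: rook_weight_def)
next
  case (Suc n)
  let ?p = "orth_poly b l"
  have rec0: "[:0, 1:] * ?p 0 = ?p 1 + smult x (?p 0)"
    by (simp add: b0)
  \<comment> \<open>The coefficient \<open>b k\<close> is split into 1 for the corner,
    \<open>k - 1 + y\<close> for the new column and \<open>k - 1 + x\<close> for the new row;
    \<open>l k\<close> is the product of the last two.\<close>
  have rec: "[:0, 1:] * ?p k = ?p (Suc k) + smult (1 + (of_nat k - 1 + y) + (of_nat k - 1 + x)) (?p k)
      + smult ((of_nat k - 1 + y) * (of_nat k - 1 + x)) (?p (k - 1))" if "k > 0" for k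
  proof -
    obtain j where j: "k = Suc j" using \<open>k > 0\<close> by (cases k) auto
    have "?p (Suc k) = [:- b k, 1:] * ?p k - smult (l k) (?p (k - 1))"
      by (simp add: j)
    also have "[:- b k, 1:] * ?p k = [:0, 1:] * ?p k - smult (b k) (?p k)"
      by simp
    finally have "[:0, 1:] * ?p k = ?p (Suc k) + smult (b k) (?p k) + smult (l k) (?p (k - 1))"
      by (simp only: algebra_simps)
    moreover have "b k = 1 + (of_nat k - 1 + y) + (of_nat k - 1 + x)"
      using b[OF that] by (simp add: algebra_simps)
    moreover have "l k = (of_nat k - 1 + y) * (of_nat k - 1 + x)"
      using l[of k] that by (simp add: mult.commute)
    ultimately show ?thesis by simp
  qed
  have "monom 1 (Suc n) = [:0, 1:] * monom (1::'r) n"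
    by (simp add: monom_Suc)
  also have "\<dots> = (\<Sum>R\<in>rook_placements n. smult (rook_weight x y R) ([:0, 1:] * ?p (n - card R)))"
    unfolding Suc.IH by (simp only: sum_distrib_left mult_smult_right)
  also have "\<dots> = (\<Sum>R\<in>rook_placements (Suc n). smult (rook_weight x y R) (?p (Suc n - card R)))"
    unfolding sum_rook_placements_Suc
  proof (intro sum.cong refl arg_cong[where f = "smult _"])
    fix R assume "R \<in> rook_placements n"
    then have "card R \<le> n" by (rule card_rook_placement_le)
    then show "[:0, 1:] * ?p (n - card R) = (if card R = n then ?p 1 + smult x (?p 0)
         else let k = n - card R; s = of_nat k - 1 + x; t = of_nat k - 1 + y
           in ?p (Suc k) + smult (1 + t + s) (?p k) + smult (t * s) (?p (k - 1)))"
    proof (cases "card R = n")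
      case True
      then show ?thesis using rec0 by (simp only: if_True simp_thms diff_self_eq_0)
    next
      case False
      with \<open>card R \<le> n\<close> have "n - card R > 0" by simp
      from rec[OF this] False show ?thesis by (simp only: Let_def if_False)
    qed
  qed
  finally show ?case .
qed

lemma moment_eq_sum_full_rook_placements:
  fixes x y :: "'r::comm_ring_1"
  assumes "b 0 = x"
    and "\<And>k. k > 0 \<Longrightarrow> b k = 2 * of_nat k - 1 + x + y"
    and "\<And>k. k \<ge> 1 \<Longrightarrow> l k = (of_nat k - 1 + x) * (of_nat k - 1 + y)"
  shows "moment b l n = (\<Sum>R | R \<in> rook_placements n \<and> card R = n. rook_weight x y R)"
proof -
  define L where "L = (THE L. moment_functional b l L)"
  have L: "moment_functional b l L"
    unfolding L_def by (rule theI'[OF moment_functional_unique])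
  then interpret module_hom smult "(*)" L by (simp add: moment_functional_def)
  have "moment b l n = L (monom 1 n)" by (simp add: moment_def L_def)
  also have "\<dots> = (\<Sum>R\<in>rook_placements n. rook_weight x y R * L (orth_poly b l (n - card R)))"
    by (simp add: monom_eq_sum_rook_placements[OF assms] sum scale)
  also have "\<dots> = (\<Sum>R\<in>rook_placements n. if card R = n then rook_weight x y R else 0)"
  proof (rule sum.cong)
    fix R assume "R \<in> rook_placements n"
    then have "card R \<le> n" by (rule card_rook_placement_le)
    then show "rook_weight x y R * L (orth_poly b l (n - card R))
        = (if card R = n then rook_weight x y R else 0)"
      using L by (auto simp: moment_functional_def)
  qed simp
  also have "\<dots> = (\<Sum>R | R \<in> rook_placements n \<and> card R = n. rook_weight x y R)"
    by (subst sum.inter_filter[OF finite_rook_placements, symmetric]) simp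
  finally show ?thesis .
qed

section \<open>Permutations as full rook placements, and their statistics\<close>

lemma bij_betw_permutations_full_rook_placements:
  "bij_betw (\<lambda>\<pi>. (\<lambda>i. (i, \<pi> i)) ` {1..n}) {\<pi>. \<pi> permutes {1..n}}
     {R. R \<in> rook_placements n \<and> card R = n}"
proof (rule bij_betw_imageI)
  show "inj_on (\<lambda>\<pi>. (\<lambda>i. (i, \<pi> i)) ` {1..n}) {\<pi>. \<pi> permutes {1..n}}"
  proof (rule inj_onI, rule ext)
    fix \<pi> \<rho> :: "nat \<Rightarrow> nat" and i
    assume perms: "\<pi> \<in> {\<pi>. \<pi> permutes {1..n}}" "\<rho> \<in> {\<pi>. \<pi> permutes {1..n}}"
      and eq: "(\<lambda>i. (i, \<pi> i)) ` {1..n} = (\<lambda>i. (i, \<rho> i)) ` {1..n}"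
    show "\<pi> i = \<rho> i"
    proof (cases "i \<in> {1..n}")
      case True
      then have "(i, \<pi> i) \<in> (\<lambda>i. (i, \<rho> i)) ` {1..n}" using eq by blast
      then show ?thesis by auto
    next
      case False
      then show ?thesis using perms permutes_not_in by (metis mem_Collect_eq)
    qed
  qed
  show "(\<lambda>\<pi>. (\<lambda>i. (i, \<pi> i)) ` {1..n}) ` {\<pi>. \<pi> permutes {1..n}}
      = {R. R \<in> rook_placements n \<and> card R = n}"
  proof (intro equalityI subsetI)
    fix R assume "R \<in> (\<lambda>\<pi>. (\<lambda>i. (i, \<pi> i)) ` {1..n}) ` {\<pi>. \<pi> permutes {1..n}}"
    then obtain \<pi> where \<pi>: "\<pi> permutes {1..n}" and R: "R = (\<lambda>i. (i, \<pi> i)) ` {1..n}" by blast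
    have "R \<subseteq> {1..n} \<times> {1..n}"
      unfolding R using permutes_in_image[OF \<pi>] by blast
    moreover have "inj_on fst R" by (auto simp: R inj_on_def)
    moreover have "card R = n" unfolding R by (subst card_image) (auto simp: inj_on_def)
    moreover have "inj_on snd R"
      using permutes_inj[OF \<pi>] by (auto simp: R inj_on_def dest: injD)
    ultimately show "R \<in> {R. R \<in> rook_placements n \<and> card R = n}"
      by (simp add: rook_placements_def)
  next
    fix R assume "R \<in> {R. R \<in> rook_placements n \<and> card R = n}"
    then have R: "R \<in> rook_placements n" and card: "card R = n" by auto
    then have inj: "inj_on fst R" "inj_on snd R" and sub: "R \<subseteq> {1..n} \<times> {1..n}"
      by (auto simp: rook_placements_def)
    \<comment> \<open>As many rooks as rows, no two attacking each other, occupy every row and every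
      column.\<close>
    have rows: "fst ` R = {1..n}" and cols: "snd ` R = {1..n}"
      using sub card inj by (intro card_subset_eq; auto simp: card_image)+
    \<comment> \<open>The placement is the graph of a function on \<open>{1..n}\<close>; outside,
      \<open>permutes\<close> demands the identity.\<close>
    define \<pi> where "\<pi> i = (if i \<in> {1..n} then THE v. (i, v) \<in> R else i)" for i
    have \<pi>_eq: "\<pi> i = v" if "(i, v) \<in> R" for i v
    proof -
      have "(THE v. (i, v) \<in> R) = v"
        using that inj_onD[OF inj(1)] by (intro the_equality) fastforce+
      then show ?thesis using that sub by (auto simp: \<pi>_def)
    qed
    have graph: "R = (\<lambda>i. (i, \<pi> i)) ` {1..n}"
      unfolding rows[symmetric] using \<pi>_eq by (force simp: image_iff)
    have "snd ` R = \<pi> ` {1..n}"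
      by (subst graph) (simp add: image_image)
    then have "bij_betw \<pi> {1..n} {1..n}"
      using cols by (simp add: bij_betw_def eq_card_imp_inj_on)
    then have "\<pi> permutes {1..n}"
      by (rule bij_imp_permutes) (simp only: \<pi>_def if_False)
    then show "R \<in> (\<lambda>\<pi>. (\<lambda>i. (i, \<pi> i)) ` {1..n}) ` {\<pi>. \<pi> permutes {1..n}}"
      using graph by blast
  qed
qed

text \<open>At a left-to-right maximum, \<open>\<pi>\<close> maps \<open>{1..i}\<close> injectively
  into \<open>{1..\<pi> i}\<close>; compare cardinalities.\<close>

lemma lr_maximum_ge:
  assumes "\<pi> permutes {1..n}" "i \<in> lr_maxima n \<pi>"
  shows "i \<le> \<pi> i"
proof -
  have "\<pi> ` {1..i} \<subseteq> {1..\<pi> i}"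
    using assms permutes_in_image[OF assms(1)]
    by (fastforce simp: lr_maxima_def le_less)
  then have "card (\<pi> ` {1..i}) \<le> card {1..\<pi> i}" by (intro card_mono) auto
  then show ?thesis
    by (simp add: card_image[OF inj_on_subset[OF permutes_inj[OF assms(1)]]])
qed

text \<open>The same count applies to the injection of \<open>{i..n}\<close> into
  \<open>{\<pi> i..n}\<close>.\<close>

lemma rl_minimum_le:
  assumes "\<pi> permutes {1..n}" "i \<in> rl_minima n \<pi>"
  shows "\<pi> i \<le> i"
proof -
  have i: "i \<in> {1..n}" using assms by (simp add: rl_minima_def)
  then have "\<pi> i \<in> {1..n}" using permutes_in_image[OF assms(1)] by blast
  have "\<pi> ` {i..n} \<subseteq> {\<pi> i..n}"
    using assms permutes_in_image[OF assms(1)] i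
    by (fastforce simp: rl_minima_def le_less)
  then have "card (\<pi> ` {i..n}) \<le> card {\<pi> i..n}" by (intro card_mono) auto
  then have "card {i..n} \<le> card {\<pi> i..n}"
    by (simp add: card_image[OF inj_on_subset[OF permutes_inj[OF assms(1)]]])
  then show ?thesis using i \<open>\<pi> i \<in> {1..n}\<close> by auto
qed

text \<open>In a full placement the \<open>x\<close> condition characterises right-to-left minima
  and the \<open>y\<close> condition left-to-right maxima. The test \<open>v \<le> i\<close> then
  disappears: right-to-left minima always satisfy it, and a left-to-right maximum satisfies it only
  if it is also a right-to-left minimum.\<close>

lemma rook_factor_permutation:
  assumes \<pi>: "\<pi> permutes {1..n}" and i: "i \<in> {1..n}"
  shows "rook_factor x y ((\<lambda>i. (i, \<pi> i)) ` {1..n}) (i, \<pi> i)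
    = (if i \<in> rl_minima n \<pi> then x else 1)
      * (if i \<in> lr_maxima n \<pi> - rl_minima n \<pi> then y else 1)"
proof -
  let ?R = "(\<lambda>i. (i, \<pi> i)) ` {1..n}"
  have range: "\<pi> j \<in> {1..n} \<longleftrightarrow> j \<in> {1..n}" for j by (rule permutes_in_image[OF \<pi>])
  have inj: "\<pi> j = \<pi> k \<longleftrightarrow> j = k" for j k using permutes_inj[OF \<pi>] by (auto dest: injD)
  have min: "(\<forall>u\<in>{1..<\<pi> i}. \<exists>j<i. (j, u) \<in> ?R) \<longleftrightarrow> i \<in> rl_minima n \<pi>"
  proof
    assume *: "\<forall>u\<in>{1..<\<pi> i}. \<exists>j<i. (j, u) \<in> ?R"
    have "\<pi> i < \<pi> j" if "j \<in> {1..n}" "j > i" for j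
    proof (rule ccontr)
      assume "\<not> \<pi> i < \<pi> j"
      then have "\<pi> j \<in> {1..<\<pi> i}" using that range[of j] inj[of i j] by auto
      with * obtain k where "k < i" "\<pi> k = \<pi> j" by fastforce
      then show False using inj that by simp
    qed
    then show "i \<in> rl_minima n \<pi>" using i by (simp add: rl_minima_def)
  next
    assume *: "i \<in> rl_minima n \<pi>"
    show "\<forall>u\<in>{1..<\<pi> i}. \<exists>j<i. (j, u) \<in> ?R"
    proof
      fix u assume u: "u \<in> {1..<\<pi> i}"
      obtain j where j: "\<pi> j = u" using permutes_surj[OF \<pi>] by (metis surjD)
      then have "j \<in> {1..n}" using u range[of i] range[of j] i by auto
      moreover have "j < i"
      proof (rule ccontr)
        assume "\<not> j < i"
        then have "\<pi> i \<le> \<pi> j"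
          using * \<open>j \<in> {1..n}\<close> by (auto simp: rl_minima_def not_less le_less)
        then show False using j u by simp
      qed
      ultimately show "\<exists>j<i. (j, u) \<in> ?R" using j by blast
    qed
  qed
  have max: "(\<forall>j\<in>{1..<i}. \<exists>u<\<pi> i. (j, u) \<in> ?R) \<longleftrightarrow> i \<in> lr_maxima n \<pi>"
    using i by (fastforce simp: lr_maxima_def image_iff)
  have "rook_factor x y ?R (i, \<pi> i) = (if \<pi> i \<le> i then (if i \<in> rl_minima n \<pi> then x else 1)
      else (if i \<in> lr_maxima n \<pi> then y else 1))"
    unfolding rook_factor_def prod.case min max ..
  \<comment> \<open>By \<open>lr_maximum_ge\<close> such an \<open>i\<close> is a fixed point.
    Earlier positions then carry values below \<open>i\<close>, hence by counting all of them, which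
    is the condition in \<open>min\<close>.\<close>
  moreover have "i \<in> rl_minima n \<pi>" if "i \<in> lr_maxima n \<pi>" "\<pi> i \<le> i"
  proof -
    have fix_i: "\<pi> i = i" using lr_maximum_ge[OF \<pi> that(1)] that(2) by simp
    have "\<pi> ` {1..<i} \<subseteq> {1..<i}"
      using that(1) range i fix_i by (fastforce simp: lr_maxima_def)
    then have image_eq: "\<pi> ` {1..<i} = {1..<i}"
      by (intro endo_inj_surj) (auto intro: inj_on_subset[OF permutes_inj[OF \<pi>]])
    have "\<exists>j<i. (j, u) \<in> ?R" if "u \<in> {1..<\<pi> i}" for u
    proof -
      have "u \<in> \<pi> ` {1..<i}" using that fix_i image_eq by simp
      then obtain j where "j \<in> {1..<i}" "u = \<pi> j" by blast
      then show ?thesis using i by auto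
    qed
    then show ?thesis using min by blast
  qed
  ultimately show ?thesis
    using rl_minimum_le[OF \<pi>, of i] by auto
qed

lemma rook_weight_permutation:
  assumes "\<pi> permutes {1..n}"
  shows "rook_weight x y ((\<lambda>i. (i, \<pi> i)) ` {1..n}) = x ^ RLmin n \<pi> * y ^ (LRmax n \<pi> - pivot n \<pi>)"
proof -
  let ?A = "rl_minima n \<pi>" and ?B = "lr_maxima n \<pi> - rl_minima n \<pi>"
  have fin: "finite (lr_maxima n \<pi>)" by (simp add: lr_maxima_def)
  have pow: "(\<Prod>i\<in>{1..n}. if i \<in> S then z else 1) = z ^ card S" if "S \<subseteq> {1..n}" for S and z :: 'a
    using that by (simp add: prod.If_cases Int_absorb1)
  have "rook_weight x y ((\<lambda>i. (i, \<pi> i)) ` {1..n})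
      = (\<Prod>i\<in>{1..n}. (if i \<in> ?A then x else 1) * (if i \<in> ?B then y else 1))"
    unfolding rook_weight_def
    by (subst prod.reindex, simp add: inj_on_def, unfold o_def)
      (intro prod.cong refl rook_factor_permutation[OF assms])
  also have "\<dots> = x ^ card ?A * y ^ card ?B"
    unfolding prod.distrib
    by (intro arg_cong2[where f = "(*)"] pow) (auto simp: rl_minima_def lr_maxima_def)
  also have "card ?B = LRmax n \<pi> - pivot n \<pi>"
    unfolding LRmax_def pivot_def using fin by (simp add: card_Diff_subset_Int)
  finally show ?thesis by (simp add: RLmin_def)
qed

theorem theorem3p3:
  fixes X Y :: "'a::comm_ring_1 poly poly"
    and b l :: "nat \<Rightarrow> 'a poly poly"
    and n :: nat
  assumes "X = indet_X" and "Y = indet_Y"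
    and "b 0 = X"
    and "\<And>k. k > 0 \<Longrightarrow> b k = 2 * of_nat k - 1 + X + Y"
    and "\<And>k. k \<ge> 1 \<Longrightarrow> l k = (of_nat k - 1 + X) * (of_nat k - 1 + Y)"
  shows "moment b l n =
    (\<Sum>\<pi> | \<pi> permutes {1..n}. X ^ RLmin n \<pi> * Y ^ (LRmax n \<pi> - pivot n \<pi>))"
proof -
  have "moment b l n = (\<Sum>R | R \<in> rook_placements n \<and> card R = n. rook_weight X Y R)"
    using assms(3-5) by (rule moment_eq_sum_full_rook_placements)
  also have "\<dots> = (\<Sum>\<pi> | \<pi> permutes {1..n}. rook_weight X Y ((\<lambda>i. (i, \<pi> i)) ` {1..n}))"
    by (rule sum.reindex_bij_betw[OF bij_betw_permutations_full_rook_placements, symmetric])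
  also have "\<dots> = (\<Sum>\<pi> | \<pi> permutes {1..n}. X ^ RLmin n \<pi> * Y ^ (LRmax n \<pi> - pivot n \<pi>))"
    by (intro sum.cong refl rook_weight_permutation) blast
  finally show ?thesis .
qed

end
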